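(* Let $\tilde w:\mathbb Z_+\to\mathbb R^{n_w}$ and $\tilde x_i=\bar x_i+v_i:\mathbb Z_+\to\mathbb R^{n_x}$, $i\in\{1,\dots,N\}$, be random signals satisfying assumptions (A1), (A2), (A3) of the context. Then $$\hat M_{\Xi_T}-\bar M_T\to0\quad\text{in probability as }T\to\infty.$$
   Context: **Notation.** $\mathbb Z_+$ is the set of nonnegative integers; $n_x,n_w,N$ are positive integers and $n_z=2n_x+n_w$. $[a;b]$ is vertical concatenation, $[v]_d$ the $d$-th entry, $A'$ the transpose. For $\alpha\in\mathbb Z_+^n$, $v\in\mathbb R^n$: $v^\alpha=\prod_d [v]_d^{[\alpha]_d}$, $\|\alpha\|_1=\sum_d[\alpha]_d$. For a signal $s$ on $\mathbb Z_+$, $s^{(T)}$ is its restriction to $\{0,\dots,T\}$. **Moments.** For a data set $\Xi=(\tilde w,\tilde x_1,\dots,\tilde x_N)$ of signals on $\{0,\dots,T\}$ let $\tilde z_i(t)=[\tilde x_i(t);\tilde x_i(t-1);\tilde w(t)]$. For $\alpha\in\mathbb Z_+^{n_z}$ with $\|\alpha\|_1\le N$, the linearized empirical moment is $$\tilde\mu_\alpha(\Xi)=\frac1T\sum_{t=1}^T\prod_{i=1}^{\|\alpha\|_1}[\tilde z_i(t)]_{\beta_\alpha(i)},\qquad \beta_\alpha(i)=\min\Big\{d\in\{1,\dots,n_z\}:\sum_{j=1}^d[\alpha]_j\ge i\Big\}.$$ For single signals on $\{0,\dots,T\}$, $\mu_\alpha(\bar x,\tilde w)=\frac1T\sum_{t=1}^T[\bar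 x(t);\bar x(t-1);\tilde w(t)]^\alpha$. Let $\aleph=\{\alpha\in\mathbb Z_+^{n_z}:2\|\alpha\|_1\le N\}=\{\alpha_1,\dots,\alpha_{|\aleph|}\}$. Define $\tilde M_\Xi\in\mathbb R^{|\aleph|\times|\aleph|}$ by $[\tilde M_\Xi]_{j_1,j_2}=\tilde\mu_{\alpha_{j_1}+\alpha_{j_2}}(\Xi)$, and let $\hat M_\Xi$ be the projection of $\frac12(\tilde M_\Xi+\tilde M_\Xi')$ onto the closed convex cone of positive semidefinite matrices. **Data.** $\Xi_T=(\tilde w^{(T)},\tilde x_1^{(T)},\dots,\tilde x_N^{(T)})$, where $\tilde x_i=\bar x_i+v_i$ and: - (A1) $\tilde w(t)$ is a stochastic process, uniformly bounded in $t$. - (A2) Each $v_i$ is a bounded, zero-mean process with values in $\mathbb R^{n_x}$, i.i.d. in $t$; $v_1,\dots,v_N$ are mutually independent, and jointly independent of $(\tilde w,\bar x_1,\dots,\bar x_N)$. - (A3) The $\bar x_i$ are stochastic processes, uniformly bounded in $i$ and $t$, and there are constants $c>0$, $\rho\in(0,1)$ such that almost surely $|\bar x_i(t)-\bar x_j(t)|\le c\rho^t$ for all $i,j\in\{1,\dots,N\}$, $t\in\mathbb Z_+$. The noiseless moment matrix is $[\bar M_T]_{j_1,j_2}=\frac1N\sum_{i=1}^N\mu_{\alpha_{j_1}+\alpha_{j_2}}(\bar x_i^{(T)},\tilde w^{(T)})$. *)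

theory Defs
  imports "HOL-Probability.Probability"
begin

text \<open>
  The index type \<open>'nx + 'nx + 'nw\<close> has \<open>2 * CARD('nx) + CARD('nw)\<close> elements.  The class \<open>enum\<close>
  supplies the order of the coordinates: \<open>enum_class.enum\<close> at a sum type lists the left summand
  before the right one, so it is the order of the vertical concatenation.
\<close>

definition entry :: "'a ^ 'n::enum \<Rightarrow> nat \<Rightarrow> 'a" where
  "entry v d = v $ (enum_class.enum ! (d - 1))"

definition stack ::
  "real ^ 'nx::enum \<Rightarrow> real ^ 'nx::enum \<Rightarrow> real ^ 'nw::enum
    \<Rightarrow> real ^ ('nx::enum + 'nx + 'nw::enum)" where
  "stack a b c = (\<chi> d. case d of Inl k \<Rightarrow> a $ k | Inr (Inl k) \<Rightarrow> b $ k | Inr (Inr k) \<Rightarrow> c $ k)"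

definition l1 :: "nat ^ 'n::enum \<Rightarrow> nat" where
  "l1 \<alpha> = (\<Sum>d=1..CARD('n). entry \<alpha> d)"

definition monomial :: "real ^ 'n::enum \<Rightarrow> nat ^ 'n::enum \<Rightarrow> real" where
  "monomial v \<alpha> = (\<Prod>d=1..CARD('n). entry v d ^ entry \<alpha> d)"

definition lin_index :: "nat ^ 'n::enum \<Rightarrow> nat \<Rightarrow> nat" where
  "lin_index \<alpha> i = Min {d \<in> {1..CARD('n)}. (\<Sum>j=1..d. entry \<alpha> j) \<ge> i}"

text \<open>
  Signals are total functions of time and the horizon \<open>T\<close> is a separate argument: the moments
  read the signals on \<open>{0..T}\<close> only, so no restriction operator is needed.
\<close>

definition lin_moment ::
  "nat \<Rightarrow> (nat \<Rightarrow> real ^ 'nw::enum) \<Rightarrow> (nat \<Rightarrow> nat \<Rightarrow> real ^ 'nx::enum)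
    \<Rightarrow> nat ^ ('nx::enum + 'nx + 'nw::enum) \<Rightarrow> real" where
  "lin_moment T w x \<alpha> =
     (1 / real T) * (\<Sum>t=1..T. \<Prod>i=1..l1 \<alpha>.
        entry (stack (x i t) (x i (t - 1)) (w t)) (lin_index \<alpha> i))"

definition moment ::
  "nat \<Rightarrow> (nat \<Rightarrow> real ^ 'nx::enum) \<Rightarrow> (nat \<Rightarrow> real ^ 'nw::enum)
    \<Rightarrow> nat ^ ('nx::enum + 'nx + 'nw::enum) \<Rightarrow> real" where
  "moment T x w \<alpha> = (1 / real T) * (\<Sum>t=1..T. monomial (stack (x t) (x (t - 1)) (w t)) \<alpha>)"

definition aleph :: "nat \<Rightarrow> (nat ^ 'n::enum) set" where
  "aleph N = {\<alpha>. 2 * l1 \<alpha> \<le> N}"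

text \<open>
  In the matrices below, \<open>a :: 'm \<Rightarrow> _\<close> is an enumeration of \<open>aleph N\<close> by the finite index type
  \<open>'m\<close>, i.e. a bijection onto it; in particular \<open>CARD('m) = card (aleph N)\<close>.
\<close>

definition M_tilde ::
  "('m::finite \<Rightarrow> nat ^ ('nx::enum + 'nx + 'nw::enum)) \<Rightarrow> nat \<Rightarrow> (nat \<Rightarrow> real ^ 'nw::enum)
    \<Rightarrow> (nat \<Rightarrow> nat \<Rightarrow> real ^ 'nx::enum) \<Rightarrow> real ^ 'm::finite ^ 'm::finite" where
  "M_tilde a T w x = (\<chi> j1 j2. lin_moment T w x (a j1 + a j2))"

definition psd_cone :: "(real ^ 'm::finite ^ 'm::finite) set" where
  "psd_cone = {A. transpose A = A \<and> (\<forall>v. 0 \<le> v \<bullet> (A *v v))}"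

text \<open>The norm of \<open>real ^ 'm ^ 'm\<close>, which \<open>closest_point\<close> minimizes, is the Frobenius norm.\<close>

definition M_hat ::
  "('m::finite \<Rightarrow> nat ^ ('nx::enum + 'nx + 'nw::enum)) \<Rightarrow> nat \<Rightarrow> (nat \<Rightarrow> real ^ 'nw::enum)
    \<Rightarrow> (nat \<Rightarrow> nat \<Rightarrow> real ^ 'nx::enum) \<Rightarrow> real ^ 'm::finite ^ 'm::finite" where
  "M_hat a T w x =
     closest_point psd_cone ((1 / 2) *\<^sub>R (M_tilde a T w x + transpose (M_tilde a T w x)))"

definition M_bar ::
  "('m::finite \<Rightarrow> nat ^ ('nx::enum + 'nx + 'nw::enum)) \<Rightarrow> nat \<Rightarrow> nat \<Rightarrow> (nat \<Rightarrow> real ^ 'nw::enum)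
    \<Rightarrow> (nat \<Rightarrow> nat \<Rightarrow> real ^ 'nx::enum) \<Rightarrow> real ^ 'm::finite ^ 'm::finite" where
  "M_bar a N T w x =
     (\<chi> j1 j2. (1 / real N) * (\<Sum>i=1..N. moment T (x i) w (a j1 + a j2)))"

definition converges_in_probability ::
  "'s measure \<Rightarrow> (nat \<Rightarrow> 's \<Rightarrow> 'b::metric_space) \<Rightarrow> 'b \<Rightarrow> bool" where
  "converges_in_probability M X L \<longleftrightarrow>
     (\<forall>n. X n \<in> borel_measurable M) \<and>
     (\<forall>\<epsilon>>0. (\<lambda>n. measure M {\<omega> \<in> space M. dist (X n \<omega>) L > \<epsilon>}) \<longlonglongrightarrow> 0)"

text \<open>The product \<open>\<sigma>\<close>-algebra on the space of signals, for independence of whole processes.\<close>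

abbreviation signals :: "(nat \<Rightarrow> 'b::topological_space) measure" where
  "signals \<equiv> PiM UNIV (\<lambda>_. borel)"

text \<open>
  The library's \<open>indep_var\<close> needs both variables to have the same value type; this is the same
  notion (compare \<open>indep_var_eq\<close>) for arbitrary value types.
\<close>

definition independent_variables ::
  "'s measure \<Rightarrow> 'b measure \<Rightarrow> ('s \<Rightarrow> 'b) \<Rightarrow> 'c measure \<Rightarrow> ('s \<Rightarrow> 'c) \<Rightarrow> bool" where
  "independent_variables M S X S' Y \<longleftrightarrow>
     X \<in> measurable M S \<and> Y \<in> measurable M S' \<and>
     prob_space.indep_set M
       {X -` A \<inter> space M | A. A \<in> sets S} {Y -` B \<inter> space M | B. B \<in> sets S'}"

end

theory Submission
  imports Defs
begin

text \<open>
  A linearized moment takes each factor of a monomial from a different noisy replica of the same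
  signal.
  Its deviation from the noiseless moment at one time splits into two parts.

  The first part is caused by the noise.  Telescoping the product writes this part as a sum of terms,
  each linear in the noise of one replica that the other factors of the term do not involve, because
  they belong to other replicas.  As that noise has mean zero and is independent of all else, this
  part has mean zero even after multiplication by anything that involves only the noise of other
  times and the noiseless signals.  A monomial at time \<open>t\<close> reads the noise at \<open>t\<close> and \<open>t - 1\<close>, so the parts at times that are at least two apart are uncorrelated (\<open>noise_effect_uncorrelated\<close>), and
  the time average over \<open>{1..T}\<close> has mean square \<open>O(1 / T)\<close> (\<open>mean_square_average_le\<close>).

  The second part is caused by the noiseless replicas not being equal.  They approach each other
  geometrically, so the differences of their products are summable in time and the average is
  almost surely \<open>O(1 / T)\<close> (\<open>mean_mismatch_effect_le\<close>).

  Hence the empirical moment matrix converges in mean square to the noiseless one.  The noiseless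
  matrix is positive semidefinite (\<open>M_bar_in_psd_cone\<close>), and neither symmetrization nor projection onto
  the cone increases the distance to a point of the cone (\<open>norm_projection_diff_le\<close>), so Markov's
  inequality finishes the proof.
\<close>

section \<open>Monomials and products\<close>

text \<open>
  The values of the index function form the word in which each \<open>d\<close> is repeated \<open>e d\<close> times: raising
  \<open>n\<close> by one appends a block of \<open>e (n + 1)\<close> copies of \<open>n + 1\<close> and leaves the earlier letters alone.
\<close>

lemma prod_over_Min_index:
  fixes f :: "nat \<Rightarrow> 'a::comm_monoid_mult" and e :: "nat \<Rightarrow> nat"
  shows "(\<Prod>i=1..(\<Sum>j=1..n. e j). f (Min {d \<in> {1..n}. (\<Sum>j=1..d. e j) \<ge> i}))
    = (\<Prod>d=1..n. f d ^ e d)"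
proof (induction n)
  case 0
  then show ?case by simp
next
  case (Suc n)
  define s where "s d = (\<Sum>j=1..d. e j)" for d
  let ?idx = "\<lambda>n i. Min {d \<in> {1..n}. s d \<ge> i}"
  have s_Suc: "s (Suc n) = s n + e (Suc n)"
    by (simp add: s_def)
  have s_mono: "s d \<le> s n" if "d \<le> n" for d
    unfolding s_def by (rule sum_mono2) (use that in auto)
  have low: "?idx (Suc n) i = ?idx n i" if "i \<in> {1..s n}" for i
  proof -
    have "n \<ge> 1" using that by (cases n) (auto simp: s_def)
    then have n: "n \<in> {d \<in> {1..n}. s d \<ge> i}" using that by auto
    have "{d \<in> {1..Suc n}. s d \<ge> i} = insert (Suc n) {d \<in> {1..n}. s d \<ge> i}"
      using that by (auto simp: s_Suc le_Suc_eq)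
    moreover have "?idx n i \<le> n"
      using n by (intro Min_le) auto
    moreover have "Min (insert (Suc n) {d \<in> {1..n}. s d \<ge> i}) = min (Suc n) (?idx n i)"
      using n by (intro Min_insert) auto
    ultimately show ?thesis
      by simp
  qed
  have high: "?idx (Suc n) i = Suc n" if "i \<in> {s n + 1..s (Suc n)}" for i
  proof -
    have "{d \<in> {1..Suc n}. s d \<ge> i} = {Suc n}"
      using that s_mono by (force simp: le_Suc_eq)
    then show ?thesis by simp
  qed
  have "(\<Prod>i=1..s (Suc n). f (?idx (Suc n) i))
      = (\<Prod>i=1..s n. f (?idx (Suc n) i)) * (\<Prod>i=s n + 1..s (Suc n). f (?idx (Suc n) i))"
    unfolding s_Suc by (rule prod.ub_add_nat) simp
  also have "(\<Prod>i=1..s n. f (?idx (Suc n) i)) = (\<Prod>i=1..s n. f (?idx n i))"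
    using low by (intro prod.cong) auto
  also have "\<dots> = (\<Prod>d=1..n. f d ^ e d)"
    using Suc.IH by (simp add: s_def)
  also have "(\<Prod>i=s n + 1..s (Suc n). f (?idx (Suc n) i)) = f (Suc n) ^ e (Suc n)"
    using high by (simp add: s_Suc)
  finally show ?case
    by (simp add: s_def)
qed

text \<open>
  Linearization does not change a moment when all replicas coincide: the noiseless moments can be
  compared factor by factor with the linearized ones.
\<close>

lemma prod_lin_index_eq_monomial:
  fixes \<alpha> :: "nat ^ 'n::enum"
  shows "(\<Prod>i=1..l1 \<alpha>. entry z (lin_index \<alpha> i)) = monomial z \<alpha>"
  using prod_over_Min_index[where f = "entry z" and e = "entry \<alpha>" and n = "CARD('n)"]
  by (simp add: l1_def lin_index_def monomial_def)

lemma entry_add: "entry (\<alpha> + \<beta>) d = entry \<alpha> d + entry \<beta> d"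
  by (simp add: entry_def)

lemma l1_add: "l1 (\<alpha> + \<beta>) = l1 \<alpha> + l1 \<beta>"
  by (simp add: l1_def entry_add sum.distrib)

lemma monomial_add: "monomial z (\<alpha> + \<beta>) = monomial z \<alpha> * monomial z \<beta>"
  by (simp add: monomial_def entry_add power_add prod.distrib)

text \<open>
  The factors are exchanged one at a time.  Each summand isolates the difference in a single
  index, and no other factor of this summand involves that index; this is what lets the independence
  of the replicas act on the summands.
\<close>

lemma prod_diff_telescope:
  fixes a b :: "nat \<Rightarrow> 'a::comm_ring_1"
  shows "(\<Prod>i=1..m. a i) - (\<Prod>i=1..m. b i)
    = (\<Sum>k=1..m. (a k - b k) * ((\<Prod>i=1..<k. a i) * (\<Prod>i=Suc k..m. b i)))"
proof (induction m)
  case 0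
  then show ?case by simp
next
  case (Suc m)
  have "(\<Sum>k=1..m. (a k - b k) * ((\<Prod>i=1..<k. a i) * (\<Prod>i=Suc k..Suc m. b i)))
      = (\<Sum>k=1..m. (a k - b k) * ((\<Prod>i=1..<k. a i) * (\<Prod>i=Suc k..m. b i))) * b (Suc m)"
    by (simp add: sum_distrib_right mult.assoc)
  then show ?case
    using Suc.IH by (simp add: algebra_simps flip: atLeastLessThanSuc_atLeastAtMost)
qed

lemma abs_prod_diff_le:
  fixes a b :: "nat \<Rightarrow> real"
  assumes "B \<ge> 1"
    and "\<And>i. i \<in> {1..m} \<Longrightarrow> \<bar>a i\<bar> \<le> B" "\<And>i. i \<in> {1..m} \<Longrightarrow> \<bar>b i\<bar> \<le> B"
    and "\<And>i. i \<in> {1..m} \<Longrightarrow> \<bar>a i - b i\<bar> \<le> \<delta>"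
  shows "\<bar>(\<Prod>i=1..m. a i) - (\<Prod>i=1..m. b i)\<bar> \<le> m * \<delta> * (B ^ m * B ^ m)"
proof -
  \<comment> \<open>Both partial products are bounded by the full power, which makes the bound independent of \<open>k\<close>.\<close>
  have "\<bar>(a k - b k) * ((\<Prod>i=1..<k. a i) * (\<Prod>i=Suc k..m. b i))\<bar> \<le> \<delta> * (B ^ m * B ^ m)"
    if k: "k \<in> {1..m}" for k
  proof -
    have "(\<Prod>i=1..<k. \<bar>a i\<bar>) \<le> (\<Prod>i=1..<k. B)"
      using assms(2) k by (intro prod_mono) auto
    also have "\<dots> \<le> B ^ m"
      using k assms(1) by (auto intro!: power_increasing)
    finally have 1: "(\<Prod>i=1..<k. \<bar>a i\<bar>) \<le> B ^ m" .
    have "(\<Prod>i=Suc k..m. \<bar>b i\<bar>) \<le> (\<Prod>i=Suc k..m. B)"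
      using assms(3) k by (intro prod_mono) auto
    also have "\<dots> \<le> B ^ m"
      using k assms(1) by (auto intro!: power_increasing)
    finally have 2: "(\<Prod>i=Suc k..m. \<bar>b i\<bar>) \<le> B ^ m" .
    show ?thesis
      unfolding abs_mult abs_prod
      using 1 2 assms(1) assms(4)[OF k] order_trans[OF abs_ge_zero assms(4)[OF k]]
      by (intro mult_mono) (auto intro!: prod_nonneg mult_nonneg_nonneg)
  qed
  then have "\<bar>(\<Prod>i=1..m. a i) - (\<Prod>i=1..m. b i)\<bar> \<le> (\<Sum>k=1..m. \<delta> * (B ^ m * B ^ m))"
    unfolding prod_diff_telescope by (intro order_trans[OF sum_abs] sum_mono)
  then show ?thesis
    by (simp add: mult.assoc)
qed

lemma abs_entry_stack_le:
  assumes "norm a \<le> B" "norm b \<le> B" "norm c \<le> B"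
  shows "\<bar>entry (stack a b c) d\<bar> \<le> B"
  unfolding entry_def stack_def
  using assms component_le_norm_cart[of a] component_le_norm_cart[of b] component_le_norm_cart[of c]
  by (auto split: sum.split intro: order_trans)

text \<open>
  Noise and contraction act on the states only; the input is common to all replicas and cancels.
\<close>

lemma entry_stack_diff:
  fixes a :: "real ^ 'nx::enum" and c :: "real ^ 'nw::enum"
  shows "entry (stack a b c) d - entry (stack a' b' c) d = entry (stack (a - a') (b - b') (0 :: real ^ 'nw::enum)) d"
  by (simp add: entry_def stack_def split: sum.split)

section \<open>Projection onto the positive semidefinite cone\<close>

lemma inner_matrix_vector:
  fixes A :: "real ^ 'm ^ 'm::finite"
  shows "u \<bullet> (A *v u) = (\<Sum>i\<in>UNIV. \<Sum>j\<in>UNIV. u $ i * A $ i $ j * u $ j)"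
  by (simp add: inner_vec_def matrix_vector_mult_def sum_distrib_left mult.assoc)

text \<open>
  Each set of the intersection is given by one linear condition on the entries, hence closed.
\<close>

lemma psd_cone_eq:
  "psd_cone = (\<Inter>i. \<Inter>j. {A :: real ^ 'm ^ 'm::finite. A $ j $ i - A $ i $ j = 0})
     \<inter> (\<Inter>u. {A. 0 \<le> (\<Sum>i\<in>UNIV. \<Sum>j\<in>UNIV. u $ i * A $ i $ j * u $ j)})"
  unfolding psd_cone_def inner_matrix_vector by (auto simp: vec_eq_iff transpose_def)

lemma closed_psd_cone: "closed (psd_cone :: (real ^ 'm ^ 'm::finite) set)"
  unfolding psd_cone_eq
  by (intro closed_Int closed_INT ballI closed_Collect_eq closed_Collect_le continuous_intros)

lemma convex_psd_cone: "convex (psd_cone :: (real ^ 'm ^ 'm::finite) set)"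
proof -
  have "transpose (s *\<^sub>R A + t *\<^sub>R C) = s *\<^sub>R transpose A + t *\<^sub>R transpose C" for s t and A C :: "real ^ 'm ^ 'm"
    by (simp add: vec_eq_iff transpose_def)
  then show ?thesis
    unfolding psd_cone_def convex_def
    by (auto simp: matrix_vector_mult_add_rdistrib inner_add_right scaleR_matrix_vector_assoc[symmetric])
qed

lemma psd_cone_nonempty: "(psd_cone :: (real ^ 'm ^ 'm::finite) set) \<noteq> {}"
proof -
  have "0 \<in> (psd_cone :: (real ^ 'm ^ 'm) set)"
    by (simp add: psd_cone_eq)
  then show ?thesis by blast
qed

lemma norm_power2_matrix:
  fixes A :: "real ^ 'm::finite ^ 'm"
  shows "(norm A)\<^sup>2 = (\<Sum>i\<in>UNIV. \<Sum>j\<in>UNIV. (A $ i $ j)\<^sup>2)"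
  unfolding power2_norm_eq_inner by (simp add: inner_vec_def power2_eq_square)

lemma norm_transpose:
  fixes A :: "real ^ 'm::finite ^ 'm"
  shows "norm (transpose A) = norm A"
proof -
  have "(norm (transpose A))\<^sup>2 = (norm A)\<^sup>2"
    unfolding norm_power2_matrix by (simp add: transpose_def) (rule sum.swap)
  then show ?thesis by simp
qed

text \<open>
  Projection onto a closed convex set is nonexpansive and fixes \<open>P\<close>.  Symmetrization is
  nonexpansive too, because \<open>P\<close> is symmetric and transposition is an isometry for the Frobenius norm.
\<close>

lemma norm_projection_diff_le:
  fixes A P :: "real ^ 'm::finite ^ 'm"
  assumes "P \<in> psd_cone"
  shows "norm (closest_point psd_cone ((1 / 2) *\<^sub>R (A + transpose A)) - P) \<le> norm (A - P)"
proof -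
  have sym: "transpose P = P"
    using assms by (simp add: psd_cone_def)
  let ?S = "(1 / 2) *\<^sub>R (A + transpose A)"
  have "norm (closest_point psd_cone ?S - P) = dist (closest_point psd_cone ?S) (closest_point psd_cone P)"
    using assms by (simp add: closest_point_self dist_norm)
  also have "\<dots> \<le> norm (?S - P)"
    using closest_point_lipschitz[OF convex_psd_cone closed_psd_cone psd_cone_nonempty]
    by (simp add: dist_norm)
  also have "?S - P = (1 / 2) *\<^sub>R ((A - P) + transpose (A - P))"
  proof -
    have "transpose (A - P) = transpose A - P"
      using sym by (simp add: transpose_def vec_eq_iff)
    then show ?thesis
      by (simp add: vec_eq_iff)
  qed
  also have "norm \<dots> \<le> (norm (A - P) + norm (transpose (A - P))) / 2"
    using norm_triangle_ineq[of "A - P" "transpose (A - P)"] by simp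
  also have "\<dots> = norm (A - P)"
    by (simp add: norm_transpose)
  finally show ?thesis .
qed

text \<open>
  The noiseless moment matrix averages the rank-one matrices \<open>z\<^sup>\<alpha> z\<^sup>\<beta>\<close>, whose quadratic forms are
  squares.
\<close>

lemma M_bar_in_psd_cone: "M_bar a N T w x \<in> psd_cone"
proof -
  let ?z = "\<lambda>i t. stack (x i t) (x i (t - 1)) (w t)"
  have entry: "M_bar a N T w x $ j1 $ j2
      = (1 / real N) * (1 / real T) * (\<Sum>i=1..N. \<Sum>t=1..T. monomial (?z i t) (a j1) * monomial (?z i t) (a j2))"
    for j1 j2
    by (simp add: M_bar_def moment_def monomial_add sum_distrib_left)
  have "transpose (M_bar a N T w x) = M_bar a N T w x"
    by (simp add: transpose_def vec_eq_iff entry mult.commute)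
  moreover have "0 \<le> u \<bullet> (M_bar a N T w x *v u)" for u
  proof -
    let ?q = "\<lambda>i t j. u $ j * monomial (?z i t) (a j)"
    have "u \<bullet> (M_bar a N T w x *v u)
        = (\<Sum>j1\<in>UNIV. \<Sum>j2\<in>UNIV. (1 / real N) * (1 / real T) * (\<Sum>i=1..N. \<Sum>t=1..T. ?q i t j1 * ?q i t j2))"
      unfolding inner_matrix_vector entry by (simp add: sum_distrib_left mult_ac)
    also have "\<dots> = (1 / real N) * (1 / real T) * (\<Sum>j1\<in>UNIV. \<Sum>j2\<in>UNIV. \<Sum>i=1..N. \<Sum>t=1..T. ?q i t j1 * ?q i t j2)"
      by (simp only: sum_distrib_left)
    also have "(\<Sum>j1\<in>UNIV. \<Sum>j2\<in>UNIV. \<Sum>i=1..N. \<Sum>t=1..T. ?q i t j1 * ?q i t j2)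
        = (\<Sum>i=1..N. \<Sum>t=1..T. \<Sum>j1\<in>UNIV. \<Sum>j2\<in>UNIV. ?q i t j1 * ?q i t j2)"
      (is "?lhs = ?rhs")
    proof -
      have "?lhs = (\<Sum>j1\<in>UNIV. \<Sum>i=1..N. \<Sum>t=1..T. \<Sum>j2\<in>UNIV. ?q i t j1 * ?q i t j2)"
        by (subst sum.swap, subst sum.swap[of _ _ "{1..T}"]) (rule refl)
      also have "\<dots> = ?rhs"
        by (subst sum.swap, subst sum.swap[of _ _ "{1..T}"]) (rule refl)
      finally show ?thesis .
    qed
    also have "\<dots> = (\<Sum>i=1..N. \<Sum>t=1..T. (\<Sum>j\<in>UNIV. ?q i t j)\<^sup>2)"
      by (simp only: power2_eq_square sum_product)
    finally have eq: "u \<bullet> (M_bar a N T w x *v u)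
        = (1 / real N) * (1 / real T) * (\<Sum>i=1..N. \<Sum>t=1..T. (\<Sum>j\<in>UNIV. ?q i t j)\<^sup>2)" .
    show ?thesis
      unfolding eq by (intro mult_nonneg_nonneg sum_nonneg) auto
  qed
  ultimately show ?thesis
    by (simp add: psd_cone_def)
qed

section \<open>Measurability and essential boundedness\<close>

lemma component_meas:
  "f \<in> borel_measurable F \<Longrightarrow> (\<lambda>\<omega>. f \<omega> $ k) \<in> borel_measurable F" for f :: "_ \<Rightarrow> real ^ 'd::finite"
  by (rule measurable_compose[OF _ borel_measurable_continuous_onI]) (auto intro: continuous_intros)

lemma entry_stack_meas:
  fixes f g :: "_ \<Rightarrow> real ^ 'nx::enum" and h :: "_ \<Rightarrow> real ^ 'nw::enum"
  assumes "f \<in> borel_measurable F" "g \<in> borel_measurable F" "h \<in> borel_measurable F"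
  shows "(\<lambda>\<omega>. entry (stack (f \<omega>) (g \<omega>) (h \<omega>)) d) \<in> borel_measurable F"
proof (cases "(enum_class.enum :: ('nx + 'nx + 'nw) list) ! (d - 1)")
  case (Inl k)
  then show ?thesis
    using component_meas[OF assms(1)] by (simp add: entry_def stack_def)
next
  case (Inr k)
  then show ?thesis
    using component_meas[OF assms(2)] component_meas[OF assms(3)]
    by (cases k) (simp_all add: entry_def stack_def)
qed

text \<open>
  The hypotheses give an exceptional null set for each index and each time; countably many of
  these are still negligible together, and finitely many bounds have a common one.
\<close>

lemma AE_uniform_bound:
  assumes "\<And>i. i \<in> I \<Longrightarrow> \<exists>C :: real. \<forall>t :: nat. AE \<omega> in M. norm (f i t \<omega>) \<le> C" and "finite I"
  shows "\<exists>C. AE \<omega> in M. \<forall>i\<in>I. \<forall>t. norm (f i t \<omega>) \<le> C"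
proof -
  obtain C where C: "\<And>i t. i \<in> I \<Longrightarrow> AE \<omega> in M. norm (f i t \<omega>) \<le> C i"
    using assms(1) by metis
  have "AE \<omega> in M. norm (f i t \<omega>) \<le> (\<Sum>i\<in>I. \<bar>C i\<bar>)" if "i \<in> I" for i t
    using C[OF that, of t]
    by eventually_elim
      (use member_le_sum[OF that, of "\<lambda>i. \<bar>C i\<bar>"] assms(2) in \<open>auto intro: order_trans\<close>)
  then have "AE \<omega> in M. \<forall>i\<in>I. \<forall>t. norm (f i t \<omega>) \<le> (\<Sum>i\<in>I. \<bar>C i\<bar>)"
    using assms(2) by (simp add: AE_ball_countable AE_all_countable countable_finite)
  then show ?thesis by blast
qed

text \<open>
  Essentially bounded functions form an algebra of integrable functions, so that the integrability
  of every polynomial in the signals follows from closure rules.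
\<close>

definition (in prob_space) ess_bounded :: "('a \<Rightarrow> real) \<Rightarrow> bool" where
  "ess_bounded f \<longleftrightarrow> f \<in> borel_measurable M \<and> (\<exists>C. AE \<omega> in M. \<bar>f \<omega>\<bar> \<le> C)"

context prob_space
begin

lemma ess_bounded_integrable: "ess_bounded f \<Longrightarrow> integrable M f"
  unfolding ess_bounded_def real_norm_def[symmetric] by (elim conjE exE) (rule integrable_const_bound)

lemma ess_bounded_measurable: "ess_bounded f \<Longrightarrow> f \<in> borel_measurable M"
  by (simp add: ess_bounded_def)

lemma ess_bounded_const: "ess_bounded (\<lambda>_. c)"
  unfolding ess_bounded_def by (auto intro: exI[of _ "\<bar>c\<bar>"])

lemma ess_bounded_mult:
  assumes "ess_bounded f" "ess_bounded g"
  shows "ess_bounded (\<lambda>\<omega>. f \<omega> * g \<omega>)"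
proof -
  obtain C1 C2 where "AE \<omega> in M. \<bar>f \<omega>\<bar> \<le> C1" "AE \<omega> in M. \<bar>g \<omega>\<bar> \<le> C2"
    using assms by (auto simp: ess_bounded_def)
  then have "AE \<omega> in M. \<bar>f \<omega> * g \<omega>\<bar> \<le> C1 * C2"
    by eventually_elim (auto simp: abs_mult intro!: mult_mono)
  then show ?thesis
    using assms by (auto simp: ess_bounded_def)
qed

lemma ess_bounded_add:
  assumes "ess_bounded f" "ess_bounded g"
  shows "ess_bounded (\<lambda>\<omega>. f \<omega> + g \<omega>)"
proof -
  obtain C1 C2 where "AE \<omega> in M. \<bar>f \<omega>\<bar> \<le> C1" "AE \<omega> in M. \<bar>g \<omega>\<bar> \<le> C2"
    using assms by (auto simp: ess_bounded_def)
  then have "AE \<omega> in M. \<bar>f \<omega> + g \<omega>\<bar> \<le> C1 + C2"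
    by eventually_elim auto
  then show ?thesis
    using assms by (auto simp: ess_bounded_def)
qed

lemma ess_bounded_diff:
  assumes "ess_bounded f" "ess_bounded g"
  shows "ess_bounded (\<lambda>\<omega>. f \<omega> - g \<omega>)"
  using ess_bounded_add[OF assms(1) ess_bounded_mult[OF ess_bounded_const[of "-1"] assms(2)]] by simp

lemma ess_bounded_sum:
  "(\<And>i. i \<in> I \<Longrightarrow> ess_bounded (f i)) \<Longrightarrow> ess_bounded (\<lambda>\<omega>. \<Sum>i\<in>I. f i \<omega>)"
  by (induction I rule: infinite_finite_induct) (auto intro: ess_bounded_const ess_bounded_add)

lemma ess_bounded_prod:
  "(\<And>i. i \<in> I \<Longrightarrow> ess_bounded (f i)) \<Longrightarrow> ess_bounded (\<lambda>\<omega>. \<Prod>i\<in>I. f i \<omega>)"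
  by (induction I rule: infinite_finite_induct) (auto intro: ess_bounded_const ess_bounded_mult)

lemmas ess_bounded_intros =
  ess_bounded_const ess_bounded_mult ess_bounded_add ess_bounded_diff ess_bounded_sum ess_bounded_prod

text \<open>
  A weak law of large numbers for sequences with dependence between neighbours: in the
  expansion of the square only the pairs with \<open>\<bar>s - t\<bar> \<le> 1\<close> survive, at most three for each \<open>s\<close>.
\<close>

lemma mean_square_average_le:
  fixes X :: "nat \<Rightarrow> 'a \<Rightarrow> real"
  assumes meas: "\<And>t. X t \<in> borel_measurable M"
    and bounded: "\<And>t. AE \<omega> in M. \<bar>X t \<omega>\<bar> \<le> C"
    and uncorrelated: "\<And>s t. 1 \<le> s \<Longrightarrow> s + 2 \<le> t \<Longrightarrow> expectation (\<lambda>\<omega>. X s \<omega> * X t \<omega>) = 0"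
  shows "expectation (\<lambda>\<omega>. ((1 / real T) * (\<Sum>t=1..T. X t \<omega>))\<^sup>2) \<le> 3 * C\<^sup>2 / T"
proof (cases "T = 0")
  case False
  have bdd: "ess_bounded (X t)" for t
    using meas bounded by (auto simp: ess_bounded_def)
  have le: "expectation (\<lambda>\<omega>. X s \<omega> * X t \<omega>) \<le> C\<^sup>2" for s t
  proof -
    have "AE \<omega> in M. X s \<omega> * X t \<omega> \<le> C\<^sup>2"
      using bounded[of s] bounded[of t]
    proof eventually_elim
      case (elim \<omega>)
      have "X s \<omega> * X t \<omega> \<le> \<bar>X s \<omega>\<bar> * \<bar>X t \<omega>\<bar>"
        by (metis abs_ge_self abs_mult)
      also have "\<dots> \<le> C * C"
        using elim by (intro mult_mono) auto
      finally show ?case by (simp add: power2_eq_square)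
    qed
    moreover have "integrable M (\<lambda>\<omega>. X s \<omega> * X t \<omega>)"
      by (intro ess_bounded_integrable ess_bounded_intros bdd)
    ultimately have "expectation (\<lambda>\<omega>. X s \<omega> * X t \<omega>) \<le> expectation (\<lambda>_. C\<^sup>2)"
      by (intro integral_mono_AE) auto
    then show ?thesis by (simp add: prob_space)
  qed
  have row: "(\<Sum>t=1..T. expectation (\<lambda>\<omega>. X s \<omega> * X t \<omega>)) \<le> 3 * C\<^sup>2" if s: "s \<in> {1..T}" for s
  proof -
    have "(\<Sum>t=1..T. expectation (\<lambda>\<omega>. X s \<omega> * X t \<omega>))
        \<le> (\<Sum>t=1..T. if t \<in> {s - 1, s, s + 1} then C\<^sup>2 else 0)"
    proof (rule sum_mono)
      fix t assume t: "t \<in> {1..T}"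
      show "expectation (\<lambda>\<omega>. X s \<omega> * X t \<omega>) \<le> (if t \<in> {s - 1, s, s + 1} then C\<^sup>2 else 0)"
      proof (cases "t \<in> {s - 1, s, s + 1}")
        case False
        then have "s + 2 \<le> t \<or> t + 2 \<le> s" by auto
        then have "expectation (\<lambda>\<omega>. X s \<omega> * X t \<omega>) = 0"
          using uncorrelated[of s t] uncorrelated[of t s] s t by (auto simp: mult.commute)
        then show ?thesis using False by simp
      qed (use le in auto)
    qed
    also have "\<dots> = card ({1..T} \<inter> {s - 1, s, s + 1}) * C\<^sup>2"
      by (subst sum.inter_restrict[symmetric]) auto
    also have "\<dots> \<le> 3 * C\<^sup>2"
    proof -
      have "card ({1..T} \<inter> {s - 1, s, s + 1}) \<le> card {s - 1, s, s + 1}"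
        by (intro card_mono) auto
      also have "\<dots> \<le> 3" by (simp add: card_insert_if)
      finally show ?thesis by (intro mult_right_mono) auto
    qed
    finally show ?thesis .
  qed
  have "expectation (\<lambda>\<omega>. ((1 / real T) * (\<Sum>t=1..T. X t \<omega>))\<^sup>2)
      = expectation (\<lambda>\<omega>. (1 / real T)\<^sup>2 * (\<Sum>s=1..T. \<Sum>t=1..T. X s \<omega> * X t \<omega>))"
    by (simp only: power_mult_distrib power2_eq_square[of "sum _ _"] sum_product)
  also have "\<dots> = (1 / real T)\<^sup>2 * (\<Sum>s=1..T. \<Sum>t=1..T. expectation (\<lambda>\<omega>. X s \<omega> * X t \<omega>))"
    by (simp add: Bochner_Integration.integral_sum ess_bounded_integrable ess_bounded_intros bdd)
  also have "\<dots> \<le> (1 / real T)\<^sup>2 * (\<Sum>s=1..T. 3 * C\<^sup>2)"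
    by (intro mult_left_mono sum_mono row) auto
  also have "\<dots> = 3 * C\<^sup>2 / T"
    using False by (simp add: power2_eq_square)
  finally show ?thesis .
qed auto

end

section \<open>Independence of the noise sources\<close>

text \<open>
  The bound \<open>B\<close> is shared by all signals so that monomials are bounded by powers of one constant.
\<close>

locale noisy_signals = prob_space M for M :: "'s measure" +
  fixes N :: nat
    and w :: "nat \<Rightarrow> 's \<Rightarrow> real ^ 'nw::enum"
    and x_bar v :: "nat \<Rightarrow> nat \<Rightarrow> 's \<Rightarrow> real ^ 'nx::enum"
    and B :: real
  assumes N_pos: "N \<ge> 1"
    and w_meas: "\<And>t. w t \<in> borel_measurable M"
    and x_bar_meas: "\<And>i t. i \<in> {1..N} \<Longrightarrow> x_bar i t \<in> borel_measurable M"
    and v_meas: "\<And>i t. i \<in> {1..N} \<Longrightarrow> v i t \<in> borel_measurable M"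
    and B_ge_1: "B \<ge> 1"
    and bounded: "AE \<omega> in M. \<forall>t. norm (w t \<omega>) \<le> B \<and>
      (\<forall>i\<in>{1..N}. norm (x_bar i t \<omega>) \<le> B \<and> norm (v i t \<omega>) \<le> B)"
    and v_zero_mean: "\<And>i t. i \<in> {1..N} \<Longrightarrow> integral\<^sup>L M (v i t) = 0"
    and v_indep_time: "\<And>i. i \<in> {1..N} \<Longrightarrow> indep_vars (\<lambda>_. borel) (v i) UNIV"
    and v_mutually_indep: "indep_vars (\<lambda>_. signals) (\<lambda>i \<omega> t. v i t \<omega>) {1..N}"
    and v_indep_signals:
      "independent_variables M
         (PiM {1..N} (\<lambda>_. signals)) (\<lambda>\<omega>. \<lambda>i\<in>{1..N}. \<lambda>t. v i t \<omega>)
         (signals \<Otimes>\<^sub>M PiM {1..N} (\<lambda>_. signals))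
           (\<lambda>\<omega>. (\<lambda>t. w t \<omega>, \<lambda>i\<in>{1..N}. \<lambda>t. x_bar i t \<omega>))"
begin

abbreviation noiseless_space where
  "noiseless_space \<equiv> (signals :: (nat \<Rightarrow> real ^ 'nw::enum) measure) \<Otimes>\<^sub>M
     PiM {1..N} (\<lambda>_. signals :: (nat \<Rightarrow> real ^ 'nx::enum) measure)"

definition noiseless where
  "noiseless \<omega> = (\<lambda>t. w t \<omega>, \<lambda>i\<in>{1..N}. \<lambda>t. x_bar i t \<omega>)"

text \<open>
  The events decided by one elementary source of randomness.  All the noiseless signals and the
  input form the single source \<open>None\<close>, since they may depend on each other in any way;
  each noise sample \<open>v i t\<close> is a source \<open>Some (i, t)\<close> of its own.
\<close>

definition source :: "(nat \<times> nat) option \<Rightarrow> 's set set" where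
  "source j = (case j of
     None \<Rightarrow> {noiseless -` A \<inter> space M | A. A \<in> sets noiseless_space}
   | Some (i, t) \<Rightarrow> {v i t -` A \<inter> space M | A. A \<in> sets borel})"

definition sources :: "(nat \<times> nat) option set" where
  "sources = insert None (Some ` ({1..N} \<times> UNIV))"

lemma noiseless_indep:
  "independent_variables M (PiM {1..N} (\<lambda>_. signals)) (\<lambda>\<omega>. \<lambda>i\<in>{1..N}. \<lambda>t. v i t \<omega>)
     noiseless_space noiseless"
  using v_indep_signals unfolding noiseless_def[abs_def] .

lemma noiseless_meas: "noiseless \<in> measurable M noiseless_space"
  using noiseless_indep by (simp add: independent_variables_def)

text \<open>
  The three layers of independence are peeled off in turn: noise against noiseless signals, replica
  against replica, and time against time within a replica.
\<close>

lemma prob_rectangle: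
  assumes Q0: "Q0 \<in> sets noiseless_space"
    and Q: "\<And>i t. i \<in> {1..N} \<Longrightarrow> Q i t \<in> sets borel"
  shows "prob {\<omega> \<in> space M. noiseless \<omega> \<in> Q0 \<and> (\<forall>i\<in>{1..N}. \<forall>t<n. v i t \<omega> \<in> Q i t)}
    = prob (noiseless -` Q0 \<inter> space M) * (\<Prod>i=1..N. \<Prod>t<n. prob (v i t -` Q i t \<inter> space M))"
proof -
  define S where "S i = {f \<in> space (signals :: (nat \<Rightarrow> real ^ 'nx::enum) measure). \<forall>t\<in>{..<n}. f t \<in> Q i t}" for i
  have S: "S i \<in> sets signals" if "i \<in> {1..N}" for i
    unfolding S_def using Q[OF that, measurable] by measurable
  let ?V = "\<lambda>\<omega>. \<lambda>i\<in>{1..N}. \<lambda>t. v i t \<omega>"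
  let ?E = "?V -` (PiE {1..N} S) \<inter> space M"
  have PiE: "PiE {1..N} S \<in> sets (PiM {1..N} (\<lambda>_. signals))"
    using S by (intro sets_PiM_I_finite) auto
  have "prob (?E \<inter> (noiseless -` Q0 \<inter> space M)) = prob ?E * prob (noiseless -` Q0 \<inter> space M)"
    by (rule indep_setD[OF conjunct2[OF conjunct2[OF noiseless_indep[unfolded independent_variables_def]]]])
      (use PiE Q0 in auto)
  moreover have "?E \<inter> (noiseless -` Q0 \<inter> space M)
      = {\<omega> \<in> space M. noiseless \<omega> \<in> Q0 \<and> (\<forall>i\<in>{1..N}. \<forall>t<n. v i t \<omega> \<in> Q i t)}"
    by (auto simp: S_def space_PiM PiE_iff)
  moreover have "?E = (\<Inter>i\<in>{1..N}. (\<lambda>\<omega> t. v i t \<omega>) -` S i \<inter> space M)"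
    using N_pos by (auto simp: PiE_iff)
  moreover have "prob (\<Inter>i\<in>{1..N}. (\<lambda>\<omega> t. v i t \<omega>) -` S i \<inter> space M)
      = (\<Prod>i=1..N. prob ((\<lambda>\<omega> t. v i t \<omega>) -` S i \<inter> space M))"
    using N_pos S by (intro indep_varsD[OF v_mutually_indep]) auto
  moreover have "prob ((\<lambda>\<omega> t. v i t \<omega>) -` S i \<inter> space M) = (\<Prod>t<n. prob (v i t -` Q i t \<inter> space M))"
    if i: "i \<in> {1..N}" for i
  proof (cases "n = 0")
    case True
    then have "(\<lambda>\<omega> t. v i t \<omega>) -` S i \<inter> space M = space M"
      by (auto simp: S_def space_PiM)
    with True show ?thesis by (simp add: prob_space)
  next
    case False
    then have "(\<lambda>\<omega> t. v i t \<omega>) -` S i \<inter> space M = (\<Inter>t\<in>{..<n}. v i t -` Q i t \<inter> space M)"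
      by (auto simp: S_def space_PiM)
    also have "prob \<dots> = (\<Prod>t<n. prob (v i t -` Q i t \<inter> space M))"
      using False Q[OF i] by (intro indep_varsD[OF v_indep_time[OF i]]) auto
    finally show ?thesis .
  qed
  ultimately show ?thesis by (simp add: mult.commute)
qed

lemma source_events: "j \<in> sources \<Longrightarrow> source j \<subseteq> events"
  using noiseless_meas v_meas by (auto simp: sources_def source_def intro: measurable_sets)

lemma space_in_source: "j \<in> sources \<Longrightarrow> space M \<in> source j"
proof -
  have "space M = noiseless -` space noiseless_space \<inter> space M"
    using measurable_space[OF noiseless_meas] by auto
  then have "space M \<in> source None"
    unfolding source_def option.case
    by (intro CollectI exI[of _ "space noiseless_space"] conjI sets.top)
  moreover have "space M \<in> source (Some (i, t))" for i t
    unfolding source_def by (auto intro!: exI[of _ UNIV])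
  ultimately show "j \<in> sources \<Longrightarrow> space M \<in> source j"
    by (auto simp: sources_def)
qed

lemma Int_stable_source: "Int_stable (source j)"
proof (cases j)
  case None
  then show ?thesis
    unfolding source_def Int_stable_def
    by (auto, rule_tac x="A \<inter> Aa" in exI) auto
next
  case (Some p)
  obtain i t where "p = (i, t)" by fastforce
  with Some show ?thesis
    unfolding source_def Int_stable_def
    by (auto, rule_tac x="A \<inter> Aa" in exI) auto
qed

text \<open>
  The three independence hypotheses together make all elementary sources jointly independent.  A finite
  family of events is padded with the sure event to a full rectangle of replicas and times, for which
  the product formula is known.
\<close>

lemma indep_sources: "indep_sets source sources"
  unfolding indep_sets_def
proof (intro conjI ballI allI impI source_events)
  fix J A assume J: "J \<subseteq> sources" "J \<noteq> {}" "finite J" and A: "A \<in> Pi J source"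
  define A' where "A' j = (if j \<in> J then A j else space M)" for j
  have A': "A' j \<in> source j" if "j \<in> sources" for j
    using that A space_in_source by (auto simp: A'_def)
  obtain Q0 where Q0: "Q0 \<in> sets noiseless_space" "A' None = noiseless -` Q0 \<inter> space M"
    using A'[of None] by (auto simp: sources_def source_def)
  have "\<forall>i\<in>{1..N}. \<forall>t. \<exists>Q. Q \<in> sets borel \<and> A' (Some (i, t)) = v i t -` Q \<inter> space M"
  proof (intro ballI allI)
    fix i t assume "i \<in> {1..N}"
    then have "A' (Some (i, t)) \<in> source (Some (i, t))"
      by (intro A') (auto simp: sources_def)
    then show "\<exists>Q. Q \<in> sets borel \<and> A' (Some (i, t)) = v i t -` Q \<inter> space M"
      by (auto simp: source_def)
  qed
  then obtain Q where Q: "\<And>i t. i \<in> {1..N} \<Longrightarrow> Q i t \<in> sets borel"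
    "\<And>i t. i \<in> {1..N} \<Longrightarrow> A' (Some (i, t)) = v i t -` Q i t \<inter> space M"
    by metis
  have "finite (snd ` Some -` J)"
    using J by (intro finite_imageI finite_vimageI) auto
  then obtain n where n: "\<And>t. t \<in> snd ` Some -` J \<Longrightarrow> t < n"
    by (metis finite_nat_set_iff_bounded)
  define K where "K = insert None (Some ` ({1..N} \<times> {..<n}))"
  have JK: "J \<subseteq> K"
    using J n by (force simp: K_def sources_def)
  have K: "finite K" "K \<subseteq> sources"
    by (auto simp: K_def sources_def)
  have A_space: "A j \<subseteq> space M" if "j \<in> J" for j
    using that A J source_events sets.sets_into_space by blast
  have "(\<Inter>j\<in>J. A j) = (\<Inter>j\<in>K. A' j)"
  proof (rule set_eqI)
    fix \<omega>
    obtain j where "j \<in> J" using J(2) by blast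
    then show "\<omega> \<in> (\<Inter>j\<in>J. A j) \<longleftrightarrow> \<omega> \<in> (\<Inter>j\<in>K. A' j)"
      using JK A_space[of j] by (auto simp: A'_def split: if_splits)
  qed
  also have "\<dots> = {\<omega> \<in> space M. noiseless \<omega> \<in> Q0 \<and> (\<forall>i\<in>{1..N}. \<forall>t<n. v i t \<omega> \<in> Q i t)}"
    unfolding K_def using Q0 Q(2) by auto
  also have "prob \<dots> = prob (A' None) * (\<Prod>i=1..N. \<Prod>t<n. prob (A' (Some (i, t))))"
    using prob_rectangle[OF Q0(1) Q(1)] by (simp add: Q0(2) Q(2))
  also have "\<dots> = (\<Prod>j\<in>K. prob (A' j))"
    by (simp add: K_def prod.reindex prod.cartesian_product case_prod_beta)
  also have "\<dots> = (\<Prod>j\<in>J. prob (A j))"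
    using K JK by (intro prod.mono_neutral_cong_right) (auto simp: A'_def prob_space)
  finally show "prob (\<Inter>j\<in>J. A j) = (\<Prod>j\<in>J. prob (A j))" .
qed

text \<open>
  What is known when only the noise sample \<open>v k r\<close> is hidden.
\<close>

definition others :: "nat \<Rightarrow> nat \<Rightarrow> 's measure" where
  "others k r = sigma (space M) (\<Union>j\<in>sources - {Some (k, r)}. source j)"

lemma space_others [simp]: "space (others k r) = space M"
  by (simp add: others_def space_measure_of_conv)

lemma sets_others: "sets (others k r) = sigma_sets (space M) (\<Union>j\<in>sources - {Some (k, r)}. source j)"
  unfolding others_def using source_events sets.sets_into_space by (intro sets_measure_of) blast

lemma source_in_others:
  assumes "j \<in> sources" "j \<noteq> Some (k, r)" "A \<in> source j"
  shows "A \<in> sets (others k r)"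
  unfolding sets_others using assms by (intro sigma_sets.Basic) auto

lemma v_others:
  assumes "i \<in> {1..N}" "(i, s) \<noteq> (k, r)"
  shows "v i s \<in> borel_measurable (others k r)"
proof (rule measurableI)
  fix A :: "(real ^ 'nx::enum) set" assume "A \<in> sets borel"
  then show "v i s -` A \<inter> space (others k r) \<in> sets (others k r)"
    using assms by (intro source_in_others[of "Some (i, s)"]) (auto simp: sources_def source_def)
qed auto

lemma noiseless_others: "noiseless \<in> measurable (others k r) noiseless_space"
proof (rule measurableI)
  fix A assume "A \<in> sets noiseless_space"
  then show "noiseless -` A \<inter> space (others k r) \<in> sets (others k r)"
    by (intro source_in_others[of None]) (auto simp: sources_def source_def)
qed (use measurable_space[OF noiseless_meas] in auto)

lemma w_others: "w t \<in> borel_measurable (others k r)"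
proof -
  have "(\<lambda>p. fst p t) \<in> borel_measurable noiseless_space"
    by measurable
  from measurable_compose[OF noiseless_others this] show ?thesis
    by (simp add: noiseless_def)
qed

lemma x_bar_others:
  assumes "i \<in> {1..N}"
  shows "x_bar i t \<in> borel_measurable (others k r)"
proof -
  have "(\<lambda>p. snd p i) \<in> measurable noiseless_space signals"
    using assms by (intro measurable_compose[OF measurable_snd] measurable_component_singleton) auto
  then have "(\<lambda>p. snd p i t) \<in> borel_measurable noiseless_space"
    by (rule measurable_compose) (rule measurable_component_singleton, simp)
  from measurable_compose[OF noiseless_others this] show ?thesis
    using assms by (simp add: noiseless_def)
qed

lemma v_component_ess_bounded:
  assumes "i \<in> {1..N}"
  shows "ess_bounded (\<lambda>\<omega>. v i t \<omega> $ k)"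
proof -
  have "AE \<omega> in M. \<bar>v i t \<omega> $ k\<bar> \<le> B"
    using bounded by eventually_elim (use assms in \<open>auto intro: order_trans[OF component_le_norm_cart]\<close>)
  then show ?thesis
    using component_meas[OF v_meas[OF assms]] by (auto simp: ess_bounded_def)
qed

lemma v_component_zero_mean:
  assumes "i \<in> {1..N}"
  shows "expectation (\<lambda>\<omega>. v i t \<omega> $ k) = 0"
proof -
  have "AE \<omega> in M. norm (v i t \<omega>) \<le> B"
    using bounded by eventually_elim (use assms in auto)
  then have "integrable M (v i t)"
    using v_meas[OF assms] by (rule integrable_const_bound)
  then show ?thesis
    using integral_bounded_linear[OF bounded_linear_vec_nth, of M "v i t" k] v_zero_mean[OF assms]
    by simp
qed

text \<open>
  The central cancellation: a noise sample has mean zero and is independent of everything else, so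
  it is orthogonal to any bounded quantity that does not involve it.
\<close>

lemma expectation_noise_times_others:
  assumes k: "k \<in> {1..N}"
    and R: "R \<in> borel_measurable (others k r)" and R_bdd: "ess_bounded R"
  shows "expectation (\<lambda>\<omega>. v k r \<omega> $ c * R \<omega>) = 0"
proof -
  let ?I = "\<lambda>j. if j then {Some (k, r)} else sources - {Some (k, r)}"
  have "indep_sets (\<lambda>j. sigma_sets (space M) (\<Union>i\<in>?I j. source i)) UNIV"
  proof (rule indep_sets_collect_sigma)
    have "(\<Union>j\<in>UNIV. ?I j) = sources"
      using k by (auto simp: sources_def UNIV_bool)
    then show "indep_sets source (\<Union>j\<in>UNIV. ?I j)"
      using indep_sources by simp
  qed (auto simp: Int_stable_source disjoint_family_on_def)
  then have indep: "indep_set (sigma_sets (space M) (source (Some (k, r)))) (sets (others k r))"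
    unfolding indep_set_def sets_others
    by (rule indep_sets_mono_sets) (auto split: bool.split)
  have "indep_var borel (\<lambda>\<omega>. v k r \<omega> $ c) borel R"
    unfolding indep_var_eq
  proof (intro conjI)
    show "random_variable borel (\<lambda>\<omega>. v k r \<omega> $ c)" "random_variable borel R"
      using component_meas[OF v_meas[OF k]] ess_bounded_measurable[OF R_bdd] by auto
    have "{(\<lambda>\<omega>. v k r \<omega> $ c) -` A \<inter> space M |A. A \<in> sets borel} \<subseteq> source (Some (k, r))"
    proof safe
      fix A :: "real set" assume "A \<in> sets borel"
      then have "(\<lambda>y :: real ^ 'nx::enum. y $ c) -` A \<inter> space borel \<in> sets borel"
        by (intro measurable_sets[OF component_meas]) auto
      then show "(\<lambda>\<omega>. v k r \<omega> $ c) -` A \<inter> space M \<in> source (Some (k, r))"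
        unfolding source_def by (auto intro!: exI[of _ "(\<lambda>y. y $ c) -` A"])
    qed
    moreover have "{R -` A \<inter> space M |A. A \<in> sets borel} \<subseteq> sets (others k r)"
      using measurable_sets[OF R] by auto
    then have "sigma_sets (space M) {R -` A \<inter> space M |A. A \<in> sets borel} \<subseteq> sets (others k r)"
      using sets.sigma_sets_subset[of _ "others k r"] by simp
    ultimately show "indep_set
        (sigma_sets (space M) {(\<lambda>\<omega>. v k r \<omega> $ c) -` A \<inter> space M |A. A \<in> sets borel})
        (sigma_sets (space M) {R -` A \<inter> space M |A. A \<in> sets borel})"
      using indep unfolding indep_set_def
      by (elim indep_sets_mono_sets) (auto split: bool.split dest: sigma_sets_mono'[THEN subsetD, rotated])
  qed
  then have "expectation (\<lambda>\<omega>. v k r \<omega> $ c * R \<omega>) = expectation (\<lambda>\<omega>. v k r \<omega> $ c) * expectation R"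
    by (intro indep_var_lebesgue_integral ess_bounded_integrable v_component_ess_bounded k R_bdd)
  then show ?thesis
    by (simp add: v_component_zero_mean[OF k])
qed

section \<open>The effect of the noise vanishes on average\<close>

definition clean_entry :: "nat \<Rightarrow> nat \<Rightarrow> nat \<Rightarrow> 's \<Rightarrow> real" where
  "clean_entry i t d \<omega> = entry (stack (x_bar i t \<omega>) (x_bar i (t - 1) \<omega>) (w t \<omega>)) d"

definition noisy_entry :: "nat \<Rightarrow> nat \<Rightarrow> nat \<Rightarrow> 's \<Rightarrow> real" where
  "noisy_entry i t d \<omega> =
     entry (stack (x_bar i t \<omega> + v i t \<omega>) (x_bar i (t - 1) \<omega> + v i (t - 1) \<omega>) (w t \<omega>)) d"

text \<open>
  What the noise adds at time \<open>t\<close> to the linearized monomial whose \<open>i\<close>-th factor is the entry \<open>b i\<close>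
  of replica \<open>i\<close>.
\<close>

definition noise_effect :: "(nat \<Rightarrow> nat) \<Rightarrow> nat \<Rightarrow> nat \<Rightarrow> 's \<Rightarrow> real" where
  "noise_effect b m t \<omega> = (\<Prod>i=1..m. noisy_entry i t (b i) \<omega>) - (\<Prod>i=1..m. clean_entry i t (b i) \<omega>)"

lemma clean_entry_others: "i \<in> {1..N} \<Longrightarrow> clean_entry i t d \<in> borel_measurable (others k r)"
  unfolding clean_entry_def by (intro entry_stack_meas x_bar_others w_others)

lemma noisy_entry_others:
  assumes "i \<in> {1..N}" "i \<noteq> k \<or> t \<noteq> r \<and> t - 1 \<noteq> r"
  shows "noisy_entry i t d \<in> borel_measurable (others k r)"
  unfolding noisy_entry_def using assms
  by (intro entry_stack_meas borel_measurable_add x_bar_others w_others v_others) auto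

lemma bounded_entries:
  "AE \<omega> in M. \<forall>i\<in>{1..N}. \<forall>t d. \<bar>clean_entry i t d \<omega>\<bar> \<le> 2 * B \<and> \<bar>noisy_entry i t d \<omega>\<bar> \<le> 2 * B"
  using bounded
proof eventually_elim
  case (elim \<omega>)
  have "norm (x_bar i t \<omega> + v i t \<omega>) \<le> 2 * B" if "i \<in> {1..N}" for i t
    using norm_triangle_ineq[of "x_bar i t \<omega>" "v i t \<omega>"] elim that by (smt (verit))
  moreover have "norm (x_bar i t \<omega>) \<le> 2 * B" "norm (w t \<omega>) \<le> 2 * B" if "i \<in> {1..N}" for i t
    using elim that B_ge_1 by (smt (verit))+
  ultimately show ?case
    unfolding clean_entry_def noisy_entry_def by (intro ballI allI conjI abs_entry_stack_le) auto
qed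

lemma clean_entry_ess_bounded:
  assumes "i \<in> {1..N}"
  shows "ess_bounded (clean_entry i t d)"
proof -
  have "clean_entry i t d \<in> borel_measurable M"
    unfolding clean_entry_def using assms by (intro entry_stack_meas x_bar_meas w_meas)
  moreover have "AE \<omega> in M. \<bar>clean_entry i t d \<omega>\<bar> \<le> 2 * B"
    using bounded_entries by eventually_elim (use assms in auto)
  ultimately show ?thesis by (auto simp: ess_bounded_def)
qed

lemma noisy_entry_ess_bounded:
  assumes "i \<in> {1..N}"
  shows "ess_bounded (noisy_entry i t d)"
proof -
  have "noisy_entry i t d \<in> borel_measurable M"
    unfolding noisy_entry_def using assms
    by (intro entry_stack_meas borel_measurable_add x_bar_meas v_meas w_meas)
  moreover have "AE \<omega> in M. \<bar>noisy_entry i t d \<omega>\<bar> \<le> 2 * B"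
    using bounded_entries by eventually_elim (use assms in auto)
  ultimately show ?thesis by (auto simp: ess_bounded_def)
qed

lemma noise_effect_ess_bounded: "m \<le> N \<Longrightarrow> ess_bounded (noise_effect b m t)"
  unfolding noise_effect_def
  by (intro ess_bounded_intros noisy_entry_ess_bounded clean_entry_ess_bounded) auto

lemma noise_effect_bound:
  assumes "m \<le> N"
  shows "AE \<omega> in M. \<bar>noise_effect b m t \<omega>\<bar> \<le> 2 * (2 * B) ^ m"
  using bounded_entries
proof eventually_elim
  case (elim \<omega>)
  have "(\<Prod>i=1..m. \<bar>noisy_entry i t (b i) \<omega>\<bar>) \<le> (\<Prod>i=1..m. 2 * B)"
    "(\<Prod>i=1..m. \<bar>clean_entry i t (b i) \<omega>\<bar>) \<le> (\<Prod>i=1..m. 2 * B)"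
    by (intro prod_mono; use elim assms in auto)+
  then have "\<bar>\<Prod>i=1..m. noisy_entry i t (b i) \<omega>\<bar> \<le> (2 * B) ^ m"
    "\<bar>\<Prod>i=1..m. clean_entry i t (b i) \<omega>\<bar> \<le> (2 * B) ^ m"
    by (simp_all add: abs_prod)
  then show ?case
    unfolding noise_effect_def by linarith
qed

text \<open>
  Depending on its position, an entry of the stacked vector carries a component of \<open>v k t\<close>, of
  \<open>v k (t - 1)\<close>, or no noise at all.
\<close>

lemma expectation_entry_noise_times_others:
  assumes k: "k \<in> {1..N}"
    and R: "\<And>r. r \<in> {t, t - 1} \<Longrightarrow> R \<in> borel_measurable (others k r)" and R_bdd: "ess_bounded R"
  shows "expectation (\<lambda>\<omega>. (noisy_entry k t d \<omega> - clean_entry k t d \<omega>) * R \<omega>) = 0"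
proof -
  let ?c = "(enum_class.enum :: ('nx + 'nx + 'nw) list) ! (d - 1)"
  have eq: "noisy_entry k t d \<omega> - clean_entry k t d \<omega>
      = (case ?c of Inl c \<Rightarrow> v k t \<omega> $ c | Inr (Inl c) \<Rightarrow> v k (t - 1) \<omega> $ c | Inr (Inr c) \<Rightarrow> 0)" for \<omega>
    unfolding noisy_entry_def clean_entry_def entry_stack_diff
    by (simp add: entry_def stack_def split: sum.split)
  show ?thesis
  proof (cases ?c)
    case (Inl c)
    then show ?thesis
      using expectation_noise_times_others[OF k R R_bdd, of t c] by (simp add: eq)
  next
    case (Inr c')
    then show ?thesis
      using expectation_noise_times_others[OF k R R_bdd, of "t - 1"] by (cases c') (simp_all add: eq)
  qed
qed

text \<open>
  Linearization is used here: in each telescoping summand of \<open>noise_effect b m s\<close> the noise of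
  replica \<open>k\<close> occurs in one factor and to the first power.  The remaining factors belong to other
  replicas, and \<open>noise_effect b m t\<close> reads the noise at the times \<open>t\<close> and \<open>t - 1\<close> only, which
  differ from \<open>s\<close> and \<open>s - 1\<close>.  So each summand has mean zero.
\<close>

lemma noise_effect_uncorrelated:
  assumes m: "m \<le> N" and st: "s + 2 \<le> t"
  shows "expectation (\<lambda>\<omega>. noise_effect b m s \<omega> * noise_effect b m t \<omega>) = 0"
proof -
  define R where "R k \<omega> = (\<Prod>i=1..<k. noisy_entry i s (b i) \<omega>) * (\<Prod>i=Suc k..m. clean_entry i s (b i) \<omega>)
    * noise_effect b m t \<omega>" for k \<omega>
  have R_bdd: "ess_bounded (R k)" if "k \<in> {1..m}" for k
    unfolding R_def using that m
    by (intro ess_bounded_intros noisy_entry_ess_bounded clean_entry_ess_bounded noise_effect_ess_bounded) auto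
  have R: "R k \<in> borel_measurable (others k r)" if "k \<in> {1..m}" "r \<in> {s, s - 1}" for k r
    unfolding R_def noise_effect_def using that m st
    by (intro borel_measurable_times borel_measurable_diff borel_measurable_prod
        noisy_entry_others clean_entry_others) auto
  have "expectation (\<lambda>\<omega>. noise_effect b m s \<omega> * noise_effect b m t \<omega>)
      = expectation (\<lambda>\<omega>. \<Sum>k=1..m. (noisy_entry k s (b k) \<omega> - clean_entry k s (b k) \<omega>) * R k \<omega>)"
    unfolding noise_effect_def[of b m s] prod_diff_telescope sum_distrib_right R_def
    by (simp only: mult.assoc)
  also have "\<dots> = (\<Sum>k=1..m. expectation (\<lambda>\<omega>. (noisy_entry k s (b k) \<omega> - clean_entry k s (b k) \<omega>) * R k \<omega>))"
    using m R_bdd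
    by (intro Bochner_Integration.integral_sum ess_bounded_integrable ess_bounded_intros
        noisy_entry_ess_bounded clean_entry_ess_bounded) auto
  also have "\<dots> = 0"
    using m R R_bdd by (intro sum.neutral ballI expectation_entry_noise_times_others) auto
  finally show ?thesis .
qed

lemma mean_square_noise_effect_le:
  assumes "m \<le> N"
  shows "expectation (\<lambda>\<omega>. ((1 / real T) * (\<Sum>t=1..T. noise_effect b m t \<omega>))\<^sup>2)
    \<le> 3 * (2 * (2 * B) ^ m)\<^sup>2 / T"
  using assms
  by (intro mean_square_average_le noise_effect_uncorrelated noise_effect_bound
      ess_bounded_measurable[OF noise_effect_ess_bounded])

end

section \<open>Replicas become indistinguishable\<close>

locale contracting_noisy_signals = noisy_signals M N w x_bar v B
  for M :: "'s measure"
    and N :: nat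
    and w :: "nat \<Rightarrow> 's \<Rightarrow> real ^ 'nw::enum"
    and x_bar v :: "nat \<Rightarrow> nat \<Rightarrow> 's \<Rightarrow> real ^ 'nx::enum"
    and B :: real +
  fixes c \<rho> :: real
  assumes c_pos: "c > 0" and \<rho>: "0 < \<rho>" "\<rho> < 1"
    and contracting: "AE \<omega> in M. \<forall>i\<in>{1..N}. \<forall>j\<in>{1..N}. \<forall>t.
      norm (x_bar i t \<omega> - x_bar j t \<omega>) \<le> c * \<rho> ^ t"
begin

text \<open>
  The cost of taking the factors of a monomial from different replicas, compared with the average
  over the replicas of the true monomials.
\<close>

definition mismatch_effect :: "(nat \<Rightarrow> nat) \<Rightarrow> nat \<Rightarrow> nat \<Rightarrow> 's \<Rightarrow> real" where
  "mismatch_effect b m t \<omega> = (\<Prod>i=1..m. clean_entry i t (b i) \<omega>)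
     - (1 / real N) * (\<Sum>j=1..N. \<Prod>i=1..m. clean_entry j t (b i) \<omega>)"

text \<open>
  The bound on the sum over all times of the mismatch: the product bound with the geometric series
  in \<open>\<rho>\<close> summed.
\<close>

definition mismatch_const :: "nat \<Rightarrow> real" where
  "mismatch_const m = m * c * ((2 * B) ^ m * (2 * B) ^ m) / (1 - \<rho>)"

text \<open>
  The entries also contain the states at time \<open>t - 1\<close>, which is why the exponent drops by one.
\<close>

lemma clean_entry_diff_le:
  assumes "\<forall>i\<in>{1..N}. \<forall>j\<in>{1..N}. \<forall>t. norm (x_bar i t \<omega> - x_bar j t \<omega>) \<le> c * \<rho> ^ t"
    and "i \<in> {1..N}" "j \<in> {1..N}"
  shows "\<bar>clean_entry i t d \<omega> - clean_entry j t d \<omega>\<bar> \<le> c * \<rho> ^ (t - 1)"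
proof -
  have "norm (x_bar i t \<omega> - x_bar j t \<omega>) \<le> c * \<rho> ^ t"
    using assms by blast
  also have "\<dots> \<le> c * \<rho> ^ (t - 1)"
    using c_pos \<rho> by (intro mult_left_mono power_decreasing) auto
  finally show ?thesis
    unfolding clean_entry_def entry_stack_diff
    using assms c_pos \<rho> by (intro abs_entry_stack_le) auto
qed

lemma mismatch_effect_le:
  assumes "m \<le> N"
  shows "AE \<omega> in M. \<forall>t. \<bar>mismatch_effect b m t \<omega>\<bar> \<le> m * (c * \<rho> ^ (t - 1)) * ((2 * B) ^ m * (2 * B) ^ m)"
  using bounded_entries contracting
proof eventually_elim
  case (elim \<omega>)
  show ?case
  proof
    fix t
    let ?p = "\<lambda>j. \<Prod>i=1..m. clean_entry (j i) t (b i) \<omega>"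
    let ?K = "m * (c * \<rho> ^ (t - 1)) * ((2 * B) ^ m * (2 * B) ^ m)"
    have eq: "mismatch_effect b m t \<omega> = (1 / real N) * (\<Sum>j=1..N. ?p (\<lambda>i. i) - ?p (\<lambda>_. j))"
      using N_pos by (simp add: mismatch_effect_def sum_subtractf field_simps)
    have "\<bar>mismatch_effect b m t \<omega>\<bar> \<le> (1 / real N) * (\<Sum>j=1..N. \<bar>?p (\<lambda>i. i) - ?p (\<lambda>_. j)\<bar>)"
      unfolding eq abs_mult by (intro mult_mono sum_abs) auto
    also have "\<dots> \<le> (1 / real N) * (\<Sum>j=1..N. ?K)"
    proof (intro mult_left_mono sum_mono)
      fix j assume "j \<in> {1..N}"
      then show "\<bar>?p (\<lambda>i. i) - ?p (\<lambda>_. j)\<bar> \<le> ?K"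
        using elim assms B_ge_1 by (intro abs_prod_diff_le clean_entry_diff_le) auto
    qed auto
    also have "\<dots> = ?K"
      using N_pos by simp
    finally show "\<bar>mismatch_effect b m t \<omega>\<bar> \<le> ?K" .
  qed
qed

text \<open>
  The mismatch is summable in time, so its time average decays like \<open>1 / T\<close>.
\<close>

lemma mean_mismatch_effect_le:
  assumes "m \<le> N"
  shows "AE \<omega> in M. \<forall>T. \<bar>(1 / real T) * (\<Sum>t=1..T. mismatch_effect b m t \<omega>)\<bar> \<le> mismatch_const m / T"
  using mismatch_effect_le[OF assms, of b]
proof eventually_elim
  case (elim \<omega>)
  show ?case
  proof
    fix T
    let ?K = "m * c * ((2 * B) ^ m * (2 * B) ^ m)"
    have "\<bar>\<Sum>t=1..T. mismatch_effect b m t \<omega>\<bar> \<le> (\<Sum>t=1..T. ?K * \<rho> ^ (t - 1))"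
      using elim by (intro order_trans[OF sum_abs] sum_mono) (simp add: mult_ac)
    also have "\<dots> = ?K * (\<Sum>t<T. \<rho> ^ t)"
      by (simp add: sum_distrib_left sum.atLeast1_atMost_eq)
    also have "\<dots> \<le> ?K * (1 / (1 - \<rho>))"
    proof (rule mult_left_mono)
      show "(\<Sum>t<T. \<rho> ^ t) \<le> 1 / (1 - \<rho>)"
        using \<rho> by (subst sum_gp_strict) (auto intro!: divide_right_mono)
    qed (use c_pos B_ge_1 in auto)
    finally have "\<bar>\<Sum>t=1..T. mismatch_effect b m t \<omega>\<bar> \<le> mismatch_const m"
      by (simp add: mismatch_const_def)
    then show "\<bar>(1 / real T) * (\<Sum>t=1..T. mismatch_effect b m t \<omega>)\<bar> \<le> mismatch_const m / T"
      by (simp add: abs_mult divide_right_mono)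
  qed
qed

section \<open>Convergence of the moment matrices\<close>

definition moment_error :: "nat ^ ('nx + 'nx + 'nw) \<Rightarrow> nat \<Rightarrow> 's \<Rightarrow> real" where
  "moment_error \<alpha> T \<omega> = lin_moment T (\<lambda>t. w t \<omega>) (\<lambda>i t. x_bar i t \<omega> + v i t \<omega>) \<alpha>
     - (1 / real N) * (\<Sum>j=1..N. moment T (\<lambda>t. x_bar j t \<omega>) (\<lambda>t. w t \<omega>) \<alpha>)"

lemma moment_error_eq:
  "moment_error \<alpha> T \<omega> = (1 / real T) * (\<Sum>t=1..T. noise_effect (lin_index \<alpha>) (l1 \<alpha>) t \<omega>)
     + (1 / real T) * (\<Sum>t=1..T. mismatch_effect (lin_index \<alpha>) (l1 \<alpha>) t \<omega>)"
proof -
  have "(\<Sum>j=1..N. moment T (\<lambda>t. x_bar j t \<omega>) (\<lambda>t. w t \<omega>) \<alpha>)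
      = (1 / real T) * (\<Sum>t=1..T. \<Sum>j=1..N. \<Prod>i=1..l1 \<alpha>. clean_entry j t (lin_index \<alpha> i) \<omega>)"
    unfolding moment_def clean_entry_def prod_lin_index_eq_monomial
    by (subst sum.swap) (simp only: sum_distrib_left)
  moreover have "lin_moment T (\<lambda>t. w t \<omega>) (\<lambda>i t. x_bar i t \<omega> + v i t \<omega>) \<alpha>
      = (1 / real T) * (\<Sum>t=1..T. \<Prod>i=1..l1 \<alpha>. noisy_entry i t (lin_index \<alpha> i) \<omega>)"
    by (simp add: lin_moment_def noisy_entry_def)
  ultimately show ?thesis
    unfolding moment_error_def noise_effect_def mismatch_effect_def sum_subtractf
      distrib_left[symmetric] sum_distrib_left[symmetric]
    by (simp add: algebra_simps)
qed

lemma mismatch_effect_ess_bounded: "m \<le> N \<Longrightarrow> ess_bounded (mismatch_effect b m t)"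
  unfolding mismatch_effect_def by (intro ess_bounded_intros clean_entry_ess_bounded) auto

lemma moment_error_ess_bounded:
  assumes "l1 \<alpha> \<le> N"
  shows "ess_bounded (moment_error \<alpha> T)"
  unfolding moment_error_eq[abs_def]
  by (intro ess_bounded_intros noise_effect_ess_bounded mismatch_effect_ess_bounded assms)

text \<open>
  The noise part has mean square of order \<open>1 / T\<close>, and the mismatch part is of order \<open>1 / T\<close>
  almost surely.
\<close>

lemma moment_error_mean_square_tendsto_0:
  assumes \<alpha>: "l1 \<alpha> \<le> N"
  shows "(\<lambda>T. expectation (\<lambda>\<omega>. (moment_error \<alpha> T \<omega>)\<^sup>2)) \<longlonglongrightarrow> 0"
proof -
  let ?m = "l1 \<alpha>" and ?b = "lin_index \<alpha>"
  define U where "U T \<omega> = (1 / real T) * (\<Sum>t=1..T. noise_effect ?b ?m t \<omega>)" for T \<omega>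
  define C where "C = 3 * (2 * (2 * B) ^ ?m)\<^sup>2"
  have U_bdd: "ess_bounded (U T)" for T
    unfolding U_def by (intro ess_bounded_intros noise_effect_ess_bounded \<alpha>)
  have square_sum_le: "(p + q)\<^sup>2 \<le> 2 * p\<^sup>2 + 2 * q\<^sup>2" for p q :: real
  proof -
    have "2 * p\<^sup>2 + 2 * q\<^sup>2 - (p + q)\<^sup>2 = (p - q)\<^sup>2"
      by (simp add: power2_eq_square algebra_simps)
    then show ?thesis
      using zero_le_power2[of "p - q"] by linarith
  qed
  have bound: "expectation (\<lambda>\<omega>. (moment_error \<alpha> T \<omega>)\<^sup>2) \<le> 2 * (C / T) + 2 * (mismatch_const ?m / T)\<^sup>2" for T
  proof -
    have "AE \<omega> in M. (moment_error \<alpha> T \<omega>)\<^sup>2 \<le> 2 * (U T \<omega>)\<^sup>2 + 2 * (mismatch_const ?m / T)\<^sup>2"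
      using mean_mismatch_effect_le[OF \<alpha>, of ?b]
    proof eventually_elim
      case (elim \<omega>)
      let ?V = "(1 / real T) * (\<Sum>t=1..T. mismatch_effect ?b ?m t \<omega>)"
      have "(moment_error \<alpha> T \<omega>)\<^sup>2 \<le> 2 * (U T \<omega>)\<^sup>2 + 2 * ?V\<^sup>2"
        unfolding moment_error_eq U_def[symmetric] by (rule square_sum_le)
      also have "?V\<^sup>2 \<le> (mismatch_const ?m / T)\<^sup>2"
        using power_mono[OF elim[rule_format, of T] abs_ge_zero, of 2] by (simp only: power2_abs)
      finally show ?case by simp
    qed
    then have "expectation (\<lambda>\<omega>. (moment_error \<alpha> T \<omega>)\<^sup>2)
        \<le> expectation (\<lambda>\<omega>. 2 * (U T \<omega>)\<^sup>2 + 2 * (mismatch_const ?m / T)\<^sup>2)"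
      unfolding power2_eq_square
      by (intro integral_mono_AE ess_bounded_integrable ess_bounded_intros U_bdd moment_error_ess_bounded \<alpha>)
    also have "\<dots> = 2 * expectation (\<lambda>\<omega>. (U T \<omega>)\<^sup>2) + 2 * (mismatch_const ?m / T)\<^sup>2"
    proof -
      have "integrable M (\<lambda>\<omega>. (U T \<omega>)\<^sup>2)"
        unfolding power2_eq_square by (intro ess_bounded_integrable ess_bounded_intros U_bdd)
      then show ?thesis by (simp add: prob_space)
    qed
    also have "\<dots> \<le> 2 * (C / T) + 2 * (mismatch_const ?m / T)\<^sup>2"
      using mean_square_noise_effect_le[OF \<alpha>, of T ?b] by (simp add: U_def C_def)
    finally show ?thesis .
  qed
  have "(\<lambda>T. K / real T) \<longlonglongrightarrow> 0" for K
    by (rule lim_const_over_n)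
  then have "(\<lambda>T. 2 * (C / real T) + 2 * (mismatch_const ?m / real T)\<^sup>2) \<longlonglongrightarrow> 2 * 0 + 2 * 0\<^sup>2"
    by (intro tendsto_intros)
  then have lim: "(\<lambda>T. 2 * (C / real T) + 2 * (mismatch_const ?m / real T)\<^sup>2) \<longlonglongrightarrow> 0"
    by simp
  show ?thesis
  proof (rule tendsto_sandwich[OF _ _ tendsto_const lim])
    show "\<forall>\<^sub>F T in sequentially. 0 \<le> expectation (\<lambda>\<omega>. (moment_error \<alpha> T \<omega>)\<^sup>2)"
      by (intro always_eventually allI integral_nonneg_AE) simp
  qed (intro always_eventually allI bound)
qed

text \<open>
  Markov's inequality turns convergence in mean square of the finitely many entries of the unprojected
  matrix into convergence in probability; the projection does not increase its distance to the
  noiseless matrix.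
\<close>

lemma M_hat_minus_M_bar_tendsto_0:
  fixes a :: "'m::finite \<Rightarrow> nat ^ ('nx::enum + 'nx + 'nw::enum)"
  assumes a: "range a \<subseteq> aleph N"
  shows "converges_in_probability M (\<lambda>T \<omega>. M_hat a T (\<lambda>t. w t \<omega>) (\<lambda>i t. x_bar i t \<omega> + v i t \<omega>)
    - M_bar a N T (\<lambda>t. w t \<omega>) (\<lambda>i t. x_bar i t \<omega>)) 0"
proof -
  let ?tilde = "\<lambda>T \<omega>. M_tilde a T (\<lambda>t. w t \<omega>) (\<lambda>i t. x_bar i t \<omega> + v i t \<omega>)"
  let ?hat = "\<lambda>T \<omega>. M_hat a T (\<lambda>t. w t \<omega>) (\<lambda>i t. x_bar i t \<omega> + v i t \<omega>)"
  let ?bar = "\<lambda>T \<omega>. M_bar a N T (\<lambda>t. w t \<omega>) (\<lambda>i t. x_bar i t \<omega>)"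
  have deg: "l1 (a j1 + a j2) \<le> N" for j1 j2
  proof -
    have "2 * l1 (a j) \<le> N" for j
      using a by (auto simp: aleph_def)
    from this[of j1] this[of j2] show ?thesis
      by (simp add: l1_add)
  qed
  have matrix_meas: "f \<in> borel_measurable M"
    if "\<And>j1 j2. (\<lambda>\<omega>. f \<omega> $ j1 $ j2) \<in> borel_measurable M" for f :: "'s \<Rightarrow> real ^ 'm ^ 'm"
    unfolding borel_measurable_euclidean_space[of f]
    using that by (auto simp: Basis_vec_def inner_axis)
  have tilde_meas: "?tilde T \<in> borel_measurable M" for T
  proof (rule matrix_meas)
    fix j1 j2
    let ?\<alpha> = "a j1 + a j2"
    have "(\<lambda>\<omega>. (1 / real T) * (\<Sum>t=1..T. \<Prod>i=1..l1 ?\<alpha>. noisy_entry i t (lin_index ?\<alpha> i) \<omega>)) \<in> borel_measurable M"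
      using deg[of j1 j2]
      by (intro ess_bounded_measurable ess_bounded_intros noisy_entry_ess_bounded) auto
    then show "(\<lambda>\<omega>. ?tilde T \<omega> $ j1 $ j2) \<in> borel_measurable M"
      by (simp add: M_tilde_def lin_moment_def noisy_entry_def)
  qed
  have diff_entry: "(?tilde T \<omega> - ?bar T \<omega>) $ j1 $ j2 = moment_error (a j1 + a j2) T \<omega>" for T \<omega> j1 j2
    by (simp add: M_tilde_def M_bar_def moment_error_def)
  have diff_meas: "(\<lambda>\<omega>. ?tilde T \<omega> - ?bar T \<omega>) \<in> borel_measurable M" for T
    by (intro matrix_meas, unfold diff_entry)
      (intro ess_bounded_measurable moment_error_ess_bounded deg)
  have bar_meas: "?bar T \<in> borel_measurable M" for T
    using borel_measurable_diff[OF tilde_meas[of T] diff_meas[of T]] by simp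
  have hat_meas: "?hat T \<in> borel_measurable M" for T
  proof -
    have "continuous_on UNIV (\<lambda>A :: real ^ 'm ^ 'm. closest_point psd_cone ((1 / 2) *\<^sub>R (A + transpose A)))"
      unfolding transpose_def
      by (intro continuous_on_compose2[OF continuous_on_closest_point[OF convex_psd_cone closed_psd_cone psd_cone_nonempty]]
          continuous_intros) auto
    from measurable_compose[OF tilde_meas borel_measurable_continuous_onI[OF this]]
    show ?thesis by (simp add: M_hat_def)
  qed
  have sq: "(norm (?tilde T \<omega> - ?bar T \<omega>))\<^sup>2 = (\<Sum>j1\<in>UNIV. \<Sum>j2\<in>UNIV. (moment_error (a j1 + a j2) T \<omega>)\<^sup>2)" for T \<omega>
    by (simp only: norm_power2_matrix diff_entry)
  have int1: "integrable M (\<lambda>\<omega>. (moment_error (a j1 + a j2) T \<omega>)\<^sup>2)" for j1 j2 T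
    unfolding power2_eq_square
    by (intro ess_bounded_integrable ess_bounded_intros moment_error_ess_bounded deg)
  have int: "integrable M (\<lambda>\<omega>. (norm (?tilde T \<omega> - ?bar T \<omega>))\<^sup>2)" for T
    unfolding sq by (intro Bochner_Integration.integrable_sum int1)
  have mean_square: "(\<lambda>T. expectation (\<lambda>\<omega>. (norm (?tilde T \<omega> - ?bar T \<omega>))\<^sup>2)) \<longlonglongrightarrow> 0"
  proof -
    have "(\<lambda>T. \<Sum>j1\<in>UNIV. \<Sum>j2\<in>UNIV. expectation (\<lambda>\<omega>. (moment_error (a j1 + a j2) T \<omega>)\<^sup>2))
        \<longlonglongrightarrow> (\<Sum>j1\<in>(UNIV :: 'm set). \<Sum>j2\<in>(UNIV :: 'm set). 0)"
      by (intro tendsto_sum moment_error_mean_square_tendsto_0 deg)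
    then show ?thesis
      unfolding sq by (simp add: Bochner_Integration.integral_sum Bochner_Integration.integrable_sum int1)
  qed
  show ?thesis
    unfolding converges_in_probability_def
  proof (intro conjI allI impI)
    show "(\<lambda>\<omega>. ?hat T \<omega> - ?bar T \<omega>) \<in> borel_measurable M" for T
      using hat_meas bar_meas by (intro borel_measurable_diff)
    fix \<epsilon> :: real assume \<epsilon>: "\<epsilon> > 0"
    have markov: "prob {\<omega> \<in> space M. dist (?hat T \<omega> - ?bar T \<omega>) 0 > \<epsilon>}
        \<le> expectation (\<lambda>\<omega>. (norm (?tilde T \<omega> - ?bar T \<omega>))\<^sup>2) / \<epsilon>\<^sup>2" for T
    proof -
      have "{\<omega> \<in> space M. dist (?hat T \<omega> - ?bar T \<omega>) 0 > \<epsilon>}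
          \<subseteq> {\<omega> \<in> space M. (norm (?tilde T \<omega> - ?bar T \<omega>))\<^sup>2 \<ge> \<epsilon>\<^sup>2}"
      proof safe
        fix \<omega> assume "dist (?hat T \<omega> - ?bar T \<omega>) 0 > \<epsilon>"
        also have "dist (?hat T \<omega> - ?bar T \<omega>) 0 \<le> norm (?tilde T \<omega> - ?bar T \<omega>)"
          using norm_projection_diff_le[OF M_bar_in_psd_cone] by (simp add: M_hat_def)
        finally show "\<epsilon>\<^sup>2 \<le> (norm (?tilde T \<omega> - ?bar T \<omega>))\<^sup>2"
          using \<epsilon> by (intro power_mono) auto
      qed
      then have "prob {\<omega> \<in> space M. dist (?hat T \<omega> - ?bar T \<omega>) 0 > \<epsilon>}
          \<le> prob {\<omega> \<in> space M. (norm (?tilde T \<omega> - ?bar T \<omega>))\<^sup>2 \<ge> \<epsilon>\<^sup>2}"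
        using borel_measurable_integrable[OF int] unfolding borel_measurable_iff_ge
        by (intro finite_measure_mono) blast+
      also have "\<dots> \<le> expectation (\<lambda>\<omega>. (norm (?tilde T \<omega> - ?bar T \<omega>))\<^sup>2) / \<epsilon>\<^sup>2"
        using \<epsilon> int by (intro integral_Markov_inequality_measure[where A="{}"]) auto
      finally show ?thesis .
    qed
    have "(\<lambda>T. expectation (\<lambda>\<omega>. (norm (?tilde T \<omega> - ?bar T \<omega>))\<^sup>2) / \<epsilon>\<^sup>2) \<longlonglongrightarrow> 0"
      using tendsto_divide[OF mean_square tendsto_const, of "\<epsilon>\<^sup>2"] \<epsilon> by simp
    then show "(\<lambda>T. prob {\<omega> \<in> space M. dist (?hat T \<omega> - ?bar T \<omega>) 0 > \<epsilon>}) \<longlonglongrightarrow> 0"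
      by (rule tendsto_sandwich[OF _ _ tendsto_const, rotated 2])
        (intro always_eventually allI measure_nonneg markov)+
  qed
qed

end

section \<open>Empirical moments are asymptotically exact\<close>

theorem lemma3:
  fixes M :: "'s measure"
    and N :: nat
    and w :: "nat \<Rightarrow> 's \<Rightarrow> real ^ 'nw::enum"
    and x_bar v x :: "nat \<Rightarrow> nat \<Rightarrow> 's \<Rightarrow> real ^ 'nx::enum"
    and a :: "'m::finite \<Rightarrow> nat ^ ('nx + 'nx + 'nw)"
  assumes "prob_space M"
    and "N \<ge> 1"
    and enumeration: "bij_betw a UNIV (aleph N)"
    and data: "\<And>i t \<omega>. i \<in> {1..N} \<Longrightarrow> \<omega> \<in> space M \<Longrightarrow> x i t \<omega> = x_bar i t \<omega> + v i t \<omega>"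
    \<comment> \<open>(A1)\<close>
    and w_process: "\<And>t. w t \<in> borel_measurable M"
    and w_bounded: "\<exists>B. \<forall>t. AE \<omega> in M. norm (w t \<omega>) \<le> B"
    \<comment> \<open>(A2)\<close>
    and v_process: "\<And>i t. i \<in> {1..N} \<Longrightarrow> v i t \<in> borel_measurable M"
    and v_bounded: "\<And>i. i \<in> {1..N} \<Longrightarrow> \<exists>B. \<forall>t. AE \<omega> in M. norm (v i t \<omega>) \<le> B"
    and v_zero_mean: "\<And>i t. i \<in> {1..N} \<Longrightarrow> integral\<^sup>L M (v i t) = 0"
    and v_indep_time: "\<And>i. i \<in> {1..N} \<Longrightarrow> prob_space.indep_vars M (\<lambda>_. borel) (v i) UNIV"
    and v_identically_distributed:
      "\<And>i s t. i \<in> {1..N} \<Longrightarrow> distr M borel (v i s) = distr M borel (v i t)"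
    and v_mutually_indep:
      "prob_space.indep_vars M (\<lambda>_. signals) (\<lambda>i \<omega> t. v i t \<omega>) {1..N}"
    and v_indep_signals:
      "independent_variables M
         (PiM {1..N} (\<lambda>_. signals)) (\<lambda>\<omega>. \<lambda>i\<in>{1..N}. \<lambda>t. v i t \<omega>)
         (signals \<Otimes>\<^sub>M PiM {1..N} (\<lambda>_. signals))
           (\<lambda>\<omega>. (\<lambda>t. w t \<omega>, \<lambda>i\<in>{1..N}. \<lambda>t. x_bar i t \<omega>))"
    \<comment> \<open>(A3)\<close>
    and x_bar_process: "\<And>i t. i \<in> {1..N} \<Longrightarrow> x_bar i t \<in> borel_measurable M"
    and x_bar_bounded: "\<exists>B. \<forall>i\<in>{1..N}. \<forall>t. AE \<omega> in M. norm (x_bar i t \<omega>) \<le> B"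
    and x_bar_contracting:
      "\<exists>c>0. \<exists>\<rho>\<in>{0<..<1}. AE \<omega> in M. \<forall>i\<in>{1..N}. \<forall>j\<in>{1..N}. \<forall>t.
         norm (x_bar i t \<omega> - x_bar j t \<omega>) \<le> c * \<rho> ^ t"
  shows "converges_in_probability M
    (\<lambda>T \<omega>. M_hat a T (\<lambda>t. w t \<omega>) (\<lambda>i t. x i t \<omega>) - M_bar a N T (\<lambda>t. w t \<omega>) (\<lambda>i t. x_bar i t \<omega>)) 0"
proof -
  interpret prob_space M by fact
  obtain Bw where Bw: "\<And>t. AE \<omega> in M. norm (w t \<omega>) \<le> Bw"
    using w_bounded by blast
  obtain Bv where Bv: "AE \<omega> in M. \<forall>i\<in>{1..N}. \<forall>t. norm (v i t \<omega>) \<le> Bv"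
    using AE_uniform_bound[where I = "{1..N}" and M = M and f = v] v_bounded by blast
  obtain Bx where Bx: "AE \<omega> in M. \<forall>i\<in>{1..N}. \<forall>t. norm (x_bar i t \<omega>) \<le> Bx"
    using AE_uniform_bound[where I = "{1..N}" and M = M and f = x_bar] x_bar_bounded by blast
  obtain c \<rho> where c: "c > 0" "\<rho> \<in> {0<..<1}"
    and contracting: "AE \<omega> in M. \<forall>i\<in>{1..N}. \<forall>j\<in>{1..N}. \<forall>t.
         norm (x_bar i t \<omega> - x_bar j t \<omega>) \<le> c * \<rho> ^ t"
    using x_bar_contracting by blast
  \<comment> \<open>The \<open>1\<close> makes powers of the bound monotone in the exponent.\<close>
  define B where "B = Max {1, Bw, Bv, Bx}"
  have B: "1 \<le> B" "Bw \<le> B" "Bv \<le> B" "Bx \<le> B"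
    by (auto simp: B_def)
  have "AE \<omega> in M. \<forall>t. norm (w t \<omega>) \<le> Bw"
    using Bw by (simp add: AE_all_countable)
  then have bounded: "AE \<omega> in M. \<forall>t. norm (w t \<omega>) \<le> B \<and>
      (\<forall>i\<in>{1..N}. norm (x_bar i t \<omega>) \<le> B \<and> norm (v i t \<omega>) \<le> B)"
    using Bv Bx by eventually_elim (use B in \<open>fastforce intro: order_trans\<close>)
  interpret contracting_noisy_signals M N w x_bar v B c \<rho>
    by unfold_locales (use assms B(1) c bounded contracting in \<open>auto simp only: greaterThanLessThan_iff\<close>)
  \<comment> \<open>The moments read the replicas \<open>i \<le> N\<close> only, where \<open>x\<close> is the noisy signal.\<close>
  have hat: "M_hat a T (\<lambda>t. w t \<omega>) (\<lambda>i t. x i t \<omega>)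
      = M_hat a T (\<lambda>t. w t \<omega>) (\<lambda>i t. x_bar i t \<omega> + v i t \<omega>)" if "\<omega> \<in> space M" for T \<omega>
  proof -
    have "l1 (a j1 + a j2) \<le> N" for j1 j2
    proof -
      have "2 * l1 (a j) \<le> N" for j
        using bij_betw_imp_surj_on[OF enumeration] by (auto simp: aleph_def)
      from this[of j1] this[of j2] show ?thesis
        by (simp add: l1_add)
    qed
    then have eq: "x i t \<omega> = x_bar i t \<omega> + v i t \<omega>" if "i \<in> {1..l1 (a j1 + a j2)}" for i t j1 j2
      using data[OF _ \<open>\<omega> \<in> space M\<close>] that by (meson atLeastAtMost_iff order_trans)
    have "lin_moment T (\<lambda>t. w t \<omega>) (\<lambda>i t. x i t \<omega>) (a j1 + a j2)
        = lin_moment T (\<lambda>t. w t \<omega>) (\<lambda>i t. x_bar i t \<omega> + v i t \<omega>) (a j1 + a j2)" for j1 j2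
      unfolding lin_moment_def
      by (intro arg_cong2[where f="(*)"] sum.cong prod.cong refl) (simp only: eq[of _ j1 j2])
    then show ?thesis
      by (simp add: M_hat_def M_tilde_def)
  qed
  show ?thesis
    using M_hat_minus_M_bar_tendsto_0[of a] bij_betw_imp_surj_on[OF enumeration]
    unfolding converges_in_probability_def
    by (simp add: hat cong: measurable_cong conj_cong)
qed

end
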